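(* Let $n\ge p$. The map defined for $\mathcal X\in\mathrm{St}(n,p,l)$ and $\mathcal V\in T_{\mathcal X}\mathrm{St}(n,p,l)$ by $$R_{\mathcal X}(\mathcal V)=(\mathcal X+\mathcal V)*(\mathcal I+\mathcal V^\top*\mathcal V)^{-1/2}$$ is a (well-defined) retraction on $\mathrm{St}(n,p,l)$.
   Context: Frontal slices $A^{(i)}=\mathcal A(:,:,i)$. The t-product is $\mathcal A*\mathcal B=\operatorname{fold}(\operatorname{bcirc}(\mathcal A)\operatorname{unfold}(\mathcal B))$, where $\operatorname{bcirc}(\mathcal A)$ is the block circulant matrix with $(i,j)$ block $A^{(((i-j)\bmod l)+1)}$, $\operatorname{unfold}$ stacks frontal slices vertically, $\operatorname{fold}$ is its inverse. Transpose: $\mathcal A^\top$ has frontal slices $(A^{(1)})^\top,(A^{(l)})^\top,\dots,(A^{(2)})^\top$. $\mathcal I$ is the identity tensor; $\mathcal A^{-1}$ denotes the t-product inverse ($\mathcal A*\mathcal A^{-1}=\mathcal A^{-1}*\mathcal A=\mathcal I$). $\mathrm{St}(n,p,l)=\{\mathcal X\in\mathbb R^{n\times p\times l}:\mathcal X^\top*\mathcal X=\mathcal I\}$, an embedded submanifold of $\mathbb R^{n\times p\times l}$. A tensor $\mathcal A\in\mathbb R^{p\times p\times l}$ with $\mathcal A=\mathcal A^\top$ is symmetric t-positive (semi)definite if $\langle\mathcal Z,\mathcal A*\mathcal Z\rangle>0$ ($\ge0$) for all nonzero $\mathcal Z\in\mathbb R^{p\times 1\times l}$; for such a t-positive semidefinite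 $\mathcal A$, $\mathcal A^{1/2}$ is the unique symmetric t-positive semidefinite tensor $\mathcal S$ with $\mathcal S*\mathcal S=\mathcal A$, and for t-positive definite $\mathcal A$, $\mathcal A^{-1/2}=(\mathcal A^{1/2})^{-1}$. A retraction on a manifold $M$ is a smooth map $R:TM\to M$ such that $R_x(0_x)=x$ and $\mathrm DR_x(0_x)=\mathrm{id}_{T_xM}$ for all $x$. *)

theory Defs
  imports "HOL-Analysis.Analysis"
begin

text \<open>A tensor in R^(n x p x l) is an element of type real^'l^'p^'n, entry A(i,j,k) = A $ i $ j $ k.
  The frontal-slice index type 'l is identified with {0..<l} (l = CARD('l)) through a fixed
  bijection slice_ix; slice number k+1 of the paper is the slice with slice_ix = k.\<close>

definition slice_ix :: "'l::finite \<Rightarrow> nat" where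
  "slice_ix = (SOME f. bij_betw f (UNIV::'l set) {..<CARD('l)})"

definition slice_of :: "nat \<Rightarrow> 'l::finite" where
  "slice_of k = inv_into UNIV (slice_ix::'l \<Rightarrow> nat) (k mod CARD('l))"

definition frontal :: "real^'l^'p^'n \<Rightarrow> nat \<Rightarrow> real^'p^'n" where
  "frontal A k = (\<chi> i j. A $ i $ j $ (slice_of k :: 'l::finite))"

definition tfold :: "(nat \<Rightarrow> real^'p^'n) \<Rightarrow> real^'l::finite^'p^'n" where
  "tfold S = (\<chi> i j k. S (slice_ix k) $ i $ j)"

text \<open>bcirc(A) unfold(B), computed block-row by block-row: block row r of bcirc(A) has block
  (r,s) equal to A^(((r-s) mod l)+1); unfold(B) has block s equal to B^(s+1).\<close>
definition tprod :: "real^'l^'m^'n \<Rightarrow> real^'l^'q^'m \<Rightarrow> real^'l::finite^'q^'n" (infixl "\<star>" 70) where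
  "tprod A B = tfold (\<lambda>r. \<Sum>s<CARD('l).
      frontal A ((r + CARD('l) - s) mod CARD('l)) ** frontal B s)"

definition ttrans :: "real^'l^'p^'n \<Rightarrow> real^'l::finite^'n^'p" where
  "ttrans A = tfold (\<lambda>k. transpose (frontal A ((CARD('l) - k) mod CARD('l))))"

definition tid :: "real^'l::finite^'p^'p" where
  "tid = tfold (\<lambda>k. if k = 0 then mat 1 else 0)"

definition tinv :: "real^'l^'p^'p \<Rightarrow> real^'l::finite^'p^'p" where
  "tinv A = (THE B. A \<star> B = tid \<and> B \<star> A = tid)"

definition t_psd :: "real^'l^'p^'p \<Rightarrow> bool" where
  "t_psd A \<longleftrightarrow> ttrans A = A \<and> (\<forall>Z::real^'l::finite^1^'p. Z \<bullet> (A \<star> Z) \<ge> 0)"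

definition t_pd :: "real^'l^'p^'p \<Rightarrow> bool" where
  "t_pd A \<longleftrightarrow> ttrans A = A \<and> (\<forall>Z::real^'l::finite^1^'p. Z \<noteq> 0 \<longrightarrow> Z \<bullet> (A \<star> Z) > 0)"

definition tsqrt :: "real^'l^'p^'p \<Rightarrow> real^'l::finite^'p^'p" where
  "tsqrt A = (THE S. t_psd S \<and> S \<star> S = A)"

definition tinvsqrt :: "real^'l^'p^'p \<Rightarrow> real^'l::finite^'p^'p" where
  "tinvsqrt A = tinv (tsqrt A)"

definition stiefel :: "(real^'l^'p^'n) set" where
  "stiefel = {X::real^'l::finite^'p^'n. ttrans X \<star> X = tid}"

fun dderiv :: "('a::real_normed_vector \<Rightarrow> 'b::real_normed_vector) \<Rightarrow> 'a list \<Rightarrow> 'a \<Rightarrow> 'b" where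
  "dderiv f [] = f"
| "dderiv f (h # hs) = (\<lambda>x. frechet_derivative (dderiv f hs) (at x) h)"

definition smooth_on_open :: "'a::real_normed_vector set \<Rightarrow> ('a \<Rightarrow> 'b::real_normed_vector) \<Rightarrow> bool" where
  "smooth_on_open U f \<longleftrightarrow> open U \<and> (\<forall>hs. dderiv f hs differentiable_on U)"

definition smooth_map_on :: "'a::real_normed_vector set \<Rightarrow> ('a \<Rightarrow> 'b::real_normed_vector) \<Rightarrow> bool" where
  "smooth_map_on S f \<longleftrightarrow> (\<forall>z\<in>S. \<exists>U g. open U \<and> z \<in> U \<and> smooth_on_open U g \<and> (\<forall>y\<in>U \<inter> S. g y = f y))"

definition tangent_space :: "'a::real_normed_vector set \<Rightarrow> 'a \<Rightarrow> 'a set" where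
  "tangent_space M x = {v. \<exists>e>0. \<exists>\<gamma>. smooth_on_open {-e<..<e} \<gamma> \<and> (\<forall>t\<in>{-e<..<e}. \<gamma> t \<in> M)
      \<and> \<gamma> 0 = x \<and> (\<gamma> has_vector_derivative v) (at 0)}"

definition tangent_bundle :: "'a::real_normed_vector set \<Rightarrow> ('a \<times> 'a) set" where
  "tangent_bundle M = {(x, v). x \<in> M \<and> v \<in> tangent_space M x}"

text \<open>Retraction: smooth R : TM -> M with R_x(0_x) = x and DR_x(0_x) = id on T_xM
  (the differential at 0 of R_x restricted to the linear space T_xM, evaluated on v).\<close>
definition is_retraction :: "'a::real_normed_vector set \<Rightarrow> ('a \<Rightarrow> 'a \<Rightarrow> 'a) \<Rightarrow> bool" where
  "is_retraction M R \<longleftrightarrow>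
     (\<forall>(x, v)\<in>tangent_bundle M. R x v \<in> M)
   \<and> smooth_map_on (tangent_bundle M) (\<lambda>(x, v). R x v)
   \<and> (\<forall>x\<in>M. R x 0 = x)
   \<and> (\<forall>x\<in>M. \<forall>v\<in>tangent_space M x. ((\<lambda>t. R x (t *\<^sub>R v)) has_vector_derivative v) (at 0))"

definition stiefel_retr :: "real^'l^'p^'n \<Rightarrow> real^'l^'p^'n \<Rightarrow> real^'l::finite^'p^'n" where
  "stiefel_retr X V = (X + V) \<star> tinvsqrt (tid + ttrans V \<star> V)"

end

(* Write S(V) = (I + V^T * V)^(1/2). The square root is unique and smooth because the Lyapunov
   operator D |-> S * D + D * T is coercive whenever S is symmetric t-positive definite and T
   is symmetric t-positive semidefinite; it exists by a contraction argument inside the tensor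
   algebra. Differentiating S * S = I + V^T * V shows that the derivative of S is again a Lyapunov
   solution, and S^(-1) is the Lyapunov solution Q of S * Q + Q * S = 2 I. Hence the class of
   functions generated by affine functions, S, products and Lyapunov solutions is closed under
   directional derivatives, so all its members are smooth on the whole ambient space. Tangency
   gives X^T * V + V^T * X = 0, so (X + V)^T * (X + V) = S * S and the retraction stays in the
   manifold. *)
theory Submission
  imports Defs
begin

section \<open>The tensor algebra\<close>

lemma bij_slice_ix: "bij_betw (slice_ix :: 'l::finite \<Rightarrow> nat) UNIV {..<CARD('l)}"
proof -
  have "\<exists>f. bij_betw f (UNIV::'l set) {..<CARD('l)}"
    using ex_bij_betw_finite_nat[OF finite[of "UNIV :: 'l set"]] by (simp add: atLeast0LessThan)
  then show ?thesis unfolding slice_ix_def by (rule someI_ex)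
qed

lemma slice_ix_less: "slice_ix (k::'l::finite) < CARD('l)"
  using bij_betwE[OF bij_slice_ix] by blast

lemma slice_of_ix [simp]: "slice_of (slice_ix k) = (k::'l::finite)"
  using bij_betw_imp_inj_on[OF bij_slice_ix[where 'l='l]]
  by (simp add: slice_of_def slice_ix_less inv_into_f_f)

lemma slice_ix_of: "slice_ix (slice_of m :: 'l::finite) = m mod CARD('l)"
  using bij_betw_inv_into_right[OF bij_slice_ix[where 'l='l], of "m mod CARD('l)"]
  by (simp add: slice_of_def)

text \<open>The slices as an l-periodic sequence over the integers, so that the t-product becomes a
  cyclic convolution without truncated subtraction.\<close>
definition fr :: "real^'l::finite^'p^'n \<Rightarrow> int \<Rightarrow> real^'p^'n" where
  "fr A k = frontal A (nat (k mod int CARD('l)))"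

lemma fr_tfold:
  "fr (tfold S :: real^'l::finite^'p^'n) k = S (nat (k mod int CARD('l)))"
proof -
  have "nat (k mod int CARD('l)) mod CARD('l) = nat (k mod int CARD('l))"
    by (simp add: nat_less_iff)
  then show ?thesis by (simp add: fr_def frontal_def tfold_def slice_ix_of)
qed

lemma fr_nth: "A $ i $ j $ k = fr A (int (slice_ix k)) $ i $ j"
  using slice_ix_less[of k] by (simp add: fr_def frontal_def)

lemma fr_eqI: "(\<And>k. fr A k = fr B k) \<Longrightarrow> A = B"
  by (simp add: vec_eq_iff fr_nth)

lemma fr_cong: "a mod int CARD('l) = b mod int CARD('l) \<Longrightarrow>
    fr (A :: real^'l::finite^'p^'n) a = fr A b"
  by (simp add: fr_def)

lemma fr_add: "fr (A + B) k = fr A k + fr B k"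
  and fr_scaleR: "fr (c *\<^sub>R A) k = c *\<^sub>R fr A k"
  by (simp_all add: fr_def frontal_def vec_eq_iff)

text \<open>Translation permutes the residues modulo \<open>L\<close>. This justifies changing the
  summation variable in the convolution sums below.\<close>

lemma sum_periodic_shift:
  fixes f :: "int \<Rightarrow> 'a::comm_monoid_add"
  assumes "\<And>a b. a mod L = b mod L \<Longrightarrow> f a = f b" and "0 < L"
  shows "(\<Sum>s\<in>{0..<L}. f (s + c)) = (\<Sum>s\<in>{0..<L}. f s)"
proof (rule sum.reindex_bij_witness[where i = "\<lambda>s. (s - c) mod L" and j = "\<lambda>s. (s + c) mod L"])
  show "f ((a + c) mod L) = f (a + c)" for a
    by (rule assms(1)) simp
qed (use assms(2) in \<open>auto simp: mod_simps\<close>)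

lemma sum_periodic_reflect:
  fixes f :: "int \<Rightarrow> 'a::comm_monoid_add"
  assumes "\<And>a b. a mod L = b mod L \<Longrightarrow> f a = f b" and "0 < L"
  shows "(\<Sum>s\<in>{0..<L}. f (- s)) = (\<Sum>s\<in>{0..<L}. f s)"
proof (rule sum.reindex_bij_witness[where i = "\<lambda>s. (- s) mod L" and j = "\<lambda>s. (- s) mod L"])
  show "f ((- a) mod L) = f (- a)" for a
    by (rule assms(1)) simp
qed (use assms(2) in \<open>auto simp: mod_simps\<close>)

text \<open>On integer indices the block circulant product is a cyclic convolution, so every
  algebraic law of the t-product reduces to a sum manipulation and a matrix law.\<close>

lemma fr_tprod:
  fixes A :: "real^'l::finite^'m^'n" and B :: "real^'l^'q^'m"
  shows "fr (A \<star> B) r = (\<Sum>s\<in>{0..<int CARD('l)}. fr A (r - s) ** fr B s)"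
proof -
  define L where "L = CARD('l)"
  have L: "0 < L" by (simp add: L_def)
  \<comment> \<open>Adding \<open>L\<close> before subtracting keeps the natural-number difference
    untruncated and does not change the residue.\<close>
  have ix: "(nat (r mod int L) + L - s) mod L = nat ((r - int s) mod int L)" if "s < L" for s
  proof -
    have "int (nat (r mod int L) + L - s) = r mod int L + int L - int s"
      using that L by (simp add: of_nat_diff)
    then have "int ((nat (r mod int L) + L - s) mod L) = (r - int s) mod int L"
      by (simp add: zmod_int mod_simps)
         (metis add_diff_eq diff_add_eq mod_add_self2 mod_diff_left_eq)
    then show ?thesis by linarith
  qed
  have "fr (A \<star> B) r = (\<Sum>s<L. frontal A ((nat (r mod int L) + L - s) mod L) ** frontal B s)"
    by (simp add: tprod_def fr_tfold L_def)
  also have "\<dots> = (\<Sum>s<L. fr A (r - int s) ** fr B (int s))"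
    by (rule sum.cong) (use ix in \<open>auto simp: fr_def L_def\<close>)
  also have "\<dots> = (\<Sum>s\<in>{0..<int L}. fr A (r - s) ** fr B s)"
    by (rule sum.reindex_bij_witness[where i = nat and j = int]) auto
  finally show ?thesis by (simp add: L_def)
qed

text \<open>Keeping the first slice and reversing the order of the others is the reflection k to -k
  of the periodic index.\<close>

lemma fr_ttrans: "fr (ttrans (A :: real^'l::finite^'p^'n)) k = transpose (fr A (- k))"
proof -
  let ?L = "int CARD('l)"
  have "int ((CARD('l) - nat (k mod ?L)) mod CARD('l)) = (- k) mod ?L"
    by (simp add: of_nat_diff zmod_int nat_le_iff less_imp_le mod_simps)
  then have "(CARD('l) - nat (k mod ?L)) mod CARD('l) = nat ((- k) mod ?L)" by linarith
  then show ?thesis by (simp add: ttrans_def fr_tfold) (simp add: fr_def)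
qed

lemma fr_tid: "fr (tid :: real^'l::finite^'p^'p) k = (if k mod int CARD('l) = 0 then mat 1 else 0)"
proof -
  have "nat (k mod int CARD('l)) = 0 \<longleftrightarrow> k mod int CARD('l) = 0"
    by (metis nat_0_iff order_antisym_conv of_nat_0_less_iff pos_mod_sign zero_less_card_finite)
  then show ?thesis by (simp add: tid_def fr_tfold)
qed

section \<open>Algebraic laws of the t-product and the transpose\<close>

lemma matrix_mult_add_distrib_right: "(A + B) ** (C::real^'q^'m) = A ** C + B ** C"
  by (simp add: matrix_matrix_mult_def vec_eq_iff sum.distrib algebra_simps)

lemma matrix_mult_sum_left: "(\<Sum>i\<in>I. f i) ** (B::real^'q^'m) = (\<Sum>i\<in>I. f i ** B)"
  by (induction I rule: infinite_finite_induct) (auto simp: matrix_mult_add_distrib_right)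

lemma matrix_mult_sum_right: "(A::real^'m^'n) ** (\<Sum>i\<in>I. f i) = (\<Sum>i\<in>I. A ** f i)"
  by (induction I rule: infinite_finite_induct) (auto simp: matrix_add_ldistrib)

lemma transpose_sum: "transpose (\<Sum>i\<in>I. f i) = (\<Sum>i\<in>I. transpose (f i :: real^'m^'n))"
  by (simp add: transpose_def vec_eq_iff)

text \<open>Associativity of convolution: substitute u = s + t in the inner sum, which periodicity
  allows, then exchange the two sums.\<close>

lemma tprod_assoc: "(A \<star> B) \<star> C = A \<star> (B \<star> (C :: real^'l::finite^'q^'m))"
proof (rule fr_eqI)
  fix r
  let ?L = "int CARD('l)"
  have "fr ((A \<star> B) \<star> C) r = (\<Sum>s\<in>{0..<?L}. \<Sum>t\<in>{0..<?L}. fr A (r - s - t) ** fr B t ** fr C s)"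
    by (simp add: fr_tprod matrix_mult_sum_left)
  also have "\<dots> = (\<Sum>s\<in>{0..<?L}. \<Sum>u\<in>{0..<?L}. fr A (r - u) ** fr B (u - s) ** fr C s)"
  proof (rule sum.cong[OF refl])
    fix s
    let ?f = "\<lambda>u. fr A (r - u) ** fr B (u - s) ** fr C s"
    have "?f a = ?f b" if "a mod ?L = b mod ?L" for a b
    proof -
      have "fr A (r - a) = fr A (r - b)" "fr B (a - s) = fr B (b - s)"
        using that by (auto intro!: fr_cong mod_diff_cong)
      then show ?thesis by simp
    qed
    from sum_periodic_shift[of ?L ?f s, OF this]
    show "(\<Sum>t\<in>{0..<?L}. fr A (r - s - t) ** fr B t ** fr C s) = (\<Sum>u\<in>{0..<?L}. ?f u)"
      by (simp add: algebra_simps)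
  qed
  also have "\<dots> = fr (A \<star> (B \<star> C)) r"
    by (subst sum.swap) (simp add: fr_tprod matrix_mult_sum_right matrix_mul_assoc)
  finally show "fr ((A \<star> B) \<star> C) r = fr (A \<star> (B \<star> C)) r" .
qed

lemma matrix_scaleR_mult_left: "(c *\<^sub>R A) ** (B::real^'q^'m) = c *\<^sub>R (A ** B)"
  and matrix_scaleR_mult_right: "A ** (c *\<^sub>R (B::real^'q^'m)) = c *\<^sub>R (A ** B)"
  by (simp_all add: matrix_matrix_mult_def vec_eq_iff sum_distrib_left mult_ac)

text \<open>Bilinearity suffices for boundedness in finite dimension. The interpretation that
  follows supplies the limit and derivative rules for products.\<close>

lemma bounded_bilinear_tprod:
  "bounded_bilinear ((\<star>) :: real^'l::finite^'m^'n \<Rightarrow> real^'l^'q^'m \<Rightarrow> real^'l^'q^'n)"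
  unfolding bilinear_conv_bounded_bilinear[symmetric] bilinear_def
  by (auto intro!: linearI fr_eqI simp: fr_tprod fr_add fr_scaleR matrix_add_ldistrib
      matrix_mult_add_distrib_right matrix_scaleR_mult_left matrix_scaleR_mult_right sum.distrib
      scaleR_sum_right)

interpretation tprod: bounded_bilinear
  "(\<star>) :: real^'l::finite^'m^'n \<Rightarrow> real^'l^'q^'m \<Rightarrow> real^'l^'q^'n"
  by (rule bounded_bilinear_tprod)

lemma bounded_linear_ttrans:
  "bounded_linear (ttrans :: real^'l::finite^'p^'n \<Rightarrow> real^'l^'n^'p)"
  unfolding linear_conv_bounded_linear[symmetric]
  by (auto intro!: linearI fr_eqI simp: fr_ttrans fr_add fr_scaleR transpose_def vec_eq_iff)

lemmas ttrans_add = linear_add[OF bounded_linear.linear[OF bounded_linear_ttrans]]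
  and ttrans_diff = linear_diff[OF bounded_linear.linear[OF bounded_linear_ttrans]]
  and ttrans_scaleR = linear_scale[OF bounded_linear.linear[OF bounded_linear_ttrans]]
  and ttrans_zero [simp] = linear_0[OF bounded_linear.linear[OF bounded_linear_ttrans]]

lemma ttrans_ttrans [simp]: "ttrans (ttrans A) = A"
  by (rule fr_eqI) (simp add: fr_ttrans)

lemma ttrans_tid [simp]: "ttrans tid = tid"
  by (rule fr_eqI) (simp add: fr_ttrans fr_tid mod_eq_0_iff_dvd, simp add: transpose_def vec_eq_iff)

text \<open>The two convolution sums differ by the shift of s by r, and matrix transposition
  reverses each factor pair.\<close>

lemma ttrans_tprod: "ttrans (A \<star> B) = ttrans B \<star> ttrans (A :: real^'l::finite^'m^'n)"
proof (rule fr_eqI)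
  fix r
  let ?L = "int CARD('l)"
  let ?f = "\<lambda>s. transpose (fr B (s - r)) ** transpose (fr A (- s))"
  have "?f a = ?f b" if "a mod ?L = b mod ?L" for a b
  proof -
    have "fr B (a - r) = fr B (b - r)" "fr A (- a) = fr A (- b)"
      using that by (auto intro!: fr_cong mod_diff_cong mod_minus_cong)
    then show ?thesis by simp
  qed
  from sum_periodic_shift[of ?L ?f r, OF this]
  have "(\<Sum>s\<in>{0..<?L}. transpose (fr B s) ** transpose (fr A (- s - r))) = (\<Sum>s\<in>{0..<?L}. ?f s)"
    by (simp add: algebra_simps)
  then show "fr (ttrans (A \<star> B)) r = fr (ttrans B \<star> ttrans A) r"
    by (simp add: fr_tprod fr_ttrans transpose_sum matrix_transpose_mul minus_diff_commute)
qed

lemma tprod_tid_left [simp]: "tid \<star> A = (A :: real^'l::finite^'q^'p)"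
proof (rule fr_eqI)
  fix r
  let ?L = "int CARD('l)"
  have "(r - s) mod ?L = 0 \<longleftrightarrow> s = r mod ?L" if "s \<in> {0..<?L}" for s
    using that by (metis atLeastLessThan_iff diff_self mod_0 mod_eq_dvd_iff mod_pos_pos_trivial dvd_eq_mod_eq_0)
  then have "fr (tid \<star> A) r = (\<Sum>s\<in>{0..<?L}. if s = r mod ?L then fr A s else 0)"
    unfolding fr_tprod by (intro sum.cong) (auto simp: fr_tid)
  also have "\<dots> = fr A (r mod ?L)" by simp
  also have "\<dots> = fr A r" by (rule fr_cong) simp
  finally show "fr (tid \<star> A) r = fr A r" .
qed

lemma tprod_tid_right [simp]: "A \<star> tid = (A :: real^'l::finite^'p^'n)"
  by (metis tprod_tid_left ttrans_tid ttrans_tprod ttrans_ttrans)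

section \<open>The inner product and adjoints\<close>

lemma inner_fr:
  fixes A B :: "real^'l::finite^'p^'n"
  shows "A \<bullet> B = (\<Sum>k\<in>{0..<int CARD('l)}. fr A k \<bullet> fr B k)"
proof -
  have "A \<bullet> B = (\<Sum>i\<in>UNIV. \<Sum>j\<in>UNIV. \<Sum>k\<in>UNIV. A $ i $ j $ k * B $ i $ j $ k)"
    by (simp add: inner_vec_def)
  also have "\<dots> = (\<Sum>i\<in>UNIV. \<Sum>k\<in>UNIV. \<Sum>j\<in>UNIV. A $ i $ j $ k * B $ i $ j $ k)"
    by (intro sum.cong refl) (rule sum.swap)
  also have "\<dots> = (\<Sum>k\<in>UNIV. \<Sum>i\<in>UNIV. \<Sum>j\<in>UNIV. A $ i $ j $ k * B $ i $ j $ k)"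
    by (rule sum.swap)
  also have "\<dots> = (\<Sum>k\<in>UNIV. fr A (int (slice_ix k)) \<bullet> fr B (int (slice_ix (k::'l))))"
    by (simp add: inner_vec_def fr_nth)
  also have "\<dots> = (\<Sum>k<CARD('l). fr A (int k) \<bullet> fr B (int k))"
    by (rule sum.reindex_bij_betw[OF bij_slice_ix])
  also have "\<dots> = (\<Sum>k\<in>{0..<int CARD('l)}. fr A k \<bullet> fr B k)"
    by (rule sum.reindex_bij_witness[where i = nat and j = int]) auto
  finally show ?thesis .
qed

lemma inner_matrix_mult: "((M::real^'m^'n) ** N) \<bullet> P = N \<bullet> (transpose M ** (P::real^'q^'n))"
proof -
  have "(M ** N) \<bullet> P = (\<Sum>i\<in>UNIV. \<Sum>j\<in>UNIV. \<Sum>k\<in>UNIV. M $ i $ k * N $ k $ j * P $ i $ j)"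
    by (simp add: inner_vec_def matrix_matrix_mult_def sum_distrib_right)
  also have "\<dots> = (\<Sum>i\<in>UNIV. \<Sum>k\<in>UNIV. \<Sum>j\<in>UNIV. M $ i $ k * N $ k $ j * P $ i $ j)"
    by (intro sum.cong refl) (rule sum.swap)
  also have "\<dots> = (\<Sum>k\<in>UNIV. \<Sum>i\<in>UNIV. \<Sum>j\<in>UNIV. M $ i $ k * N $ k $ j * P $ i $ j)"
    by (rule sum.swap)
  also have "\<dots> = (\<Sum>k\<in>UNIV. \<Sum>j\<in>UNIV. \<Sum>i\<in>UNIV. M $ i $ k * N $ k $ j * P $ i $ j)"
    by (intro sum.cong refl) (rule sum.swap)
  also have "\<dots> = N \<bullet> (transpose M ** P)"
    by (simp add: inner_vec_def matrix_matrix_mult_def sum_distrib_left transpose_def mult_ac)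
  finally show ?thesis .
qed

text \<open>Exchanging the slice sums reduces this to the matrix case, and the index r - s becomes s
  - r, which is the reflection built into \<open>ttrans\<close>.\<close>

lemma inner_tprod_left:
  "(A \<star> B) \<bullet> C = B \<bullet> (ttrans (A :: real^'l::finite^'m^'n) \<star> C)"
  unfolding inner_fr fr_tprod inner_sum_left inner_sum_right
  by (subst sum.swap) (simp add: inner_matrix_mult fr_ttrans)

text \<open>Reflection permutes the slices of a period and matrix transposition permutes entries.
  The resulting isometry is what later turns right multiplication into left multiplication.\<close>

lemma inner_ttrans: "ttrans A \<bullet> ttrans B = (A :: real^'l::finite^'p^'n) \<bullet> B"
proof -
  let ?L = "int CARD('l)"
  have "ttrans A \<bullet> ttrans B = (\<Sum>k\<in>{0..<?L}. fr A (- k) \<bullet> fr B (- k))"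
    unfolding inner_fr fr_ttrans
    by (intro sum.cong refl, simp add: inner_vec_def transpose_def) (rule sum.swap)
  also have "\<dots> = (\<Sum>k\<in>{0..<?L}. fr A k \<bullet> fr B k)"
    by (rule sum_periodic_reflect[of ?L "\<lambda>k. fr A k \<bullet> fr B k"])
      (simp_all, metis fr_cong)
  finally show ?thesis by (simp add: inner_fr)
qed

lemma norm_ttrans [simp]: "norm (ttrans A) = norm A"
  by (simp add: norm_eq_sqrt_inner inner_ttrans)

section \<open>Lyapunov equations and square roots\<close>

text \<open>A lateral slice kept as a third-order tensor: definiteness is defined by testing on such
  slices, and left multiplication acts on each of them separately.\<close>

definition tcol :: "'q \<Rightarrow> real^'l^'q^'p \<Rightarrow> real^'l::finite^1^'p" where
  "tcol j Z = (\<chi> i u k. Z $ i $ j $ k)"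

lemma fr_tcol: "fr (tcol j Y) k = (\<chi> i u. fr Y k $ i $ j)"
  by (simp add: fr_def frontal_def tcol_def)

lemma tcol_tprod: "tcol j (A \<star> Z) = A \<star> tcol j (Z :: real^'l::finite^'q^'p)"
  by (rule fr_eqI) (simp add: fr_tcol fr_tprod matrix_matrix_mult_def vec_eq_iff)

lemma inner_tcol: "Y \<bullet> Z = (\<Sum>j\<in>UNIV. tcol j Y \<bullet> tcol j (Z :: real^'l::finite^'q^'p))"
  by (simp add: inner_vec_def tcol_def) (rule sum.swap)

text \<open>Coercivity is tested on square tensors because it is applied to unknowns of Lyapunov
  equations. The explicit constant \<open>m\<close> feeds the norm estimates.\<close>

definition tbelow :: "real \<Rightarrow> real^'l::finite^'p^'p \<Rightarrow> bool" where
  "tbelow m A \<longleftrightarrow> (\<forall>Z::real^'l^'p^'p. m * (Z \<bullet> Z) \<le> Z \<bullet> (A \<star> Z))"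

lemma tbelowD: "tbelow m A \<Longrightarrow> m * (Z \<bullet> Z) \<le> Z \<bullet> (A \<star> Z)"
  for Z :: "real^'l::finite^'p^'p"
  by (simp add: tbelow_def)

text \<open>Repeating one column \<open>CARD('p)\<close> times multiplies both sides by the same
  factor; conversely, the inequalities for the columns of a square tensor add up.\<close>

lemma tbelow_iff:
  "tbelow m A \<longleftrightarrow> (\<forall>Z::real^'l::finite^1^'p. m * (Z \<bullet> Z) \<le> Z \<bullet> (A \<star> Z))"
proof
  assume A: "tbelow m A"
  show "\<forall>Z::real^'l^1^'p. m * (Z \<bullet> Z) \<le> Z \<bullet> (A \<star> Z)"
  proof
    fix Z :: "real^'l^1^'p"
    define Y :: "real^'l^'p^'p" where "Y = (\<chi> i j k. Z $ i $ 1 $ k)"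
    have Y: "tcol j Y = Z" for j
      by (simp add: Y_def tcol_def vec_eq_iff)
    have "m * (Y \<bullet> Y) \<le> Y \<bullet> (A \<star> Y)" using A by (simp add: tbelow_def)
    then have "real CARD('p) * (m * (Z \<bullet> Z)) \<le> real CARD('p) * (Z \<bullet> (A \<star> Z))"
      by (simp add: inner_tcol[where 'q='p] tcol_tprod Y mult_ac)
    then show "m * (Z \<bullet> Z) \<le> Z \<bullet> (A \<star> Z)" by simp
  qed
next
  assume "\<forall>Z::real^'l^1^'p. m * (Z \<bullet> Z) \<le> Z \<bullet> (A \<star> Z)"
  then show "tbelow m A"
    by (auto simp: tbelow_def inner_tcol[where 'q='p] tcol_tprod sum_distrib_left intro!: sum_mono)
qed

lemma t_psd_iff: "t_psd A \<longleftrightarrow> ttrans A = A \<and> tbelow 0 A"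
  by (simp add: t_psd_def tbelow_iff)

lemma t_pd_if_tbelow: "ttrans A = A \<Longrightarrow> tbelow m A \<Longrightarrow> 0 < m \<Longrightarrow> t_pd A"
  unfolding t_pd_def tbelow_iff
  by (meson inner_gt_zero_iff less_le_trans mult_pos_pos)

lemma tbelow_0_if: "tbelow m A \<Longrightarrow> 0 \<le> m \<Longrightarrow> tbelow 0 A"
  unfolding tbelow_def by (metis inner_ge_zero mult_nonneg_nonneg mult_zero_left order_trans)

text \<open>The Gram term contributes the squared norm of V * Z. No tangency enters, so the square
  root is available for every ambient \<open>V\<close>.\<close>

lemma tbelow_gram: "tbelow 1 (tid + ttrans V \<star> (V :: real^'l::finite^'p^'n))"
proof -
  have "Z \<bullet> (ttrans V \<star> (V \<star> Z)) = (V \<star> Z) \<bullet> (V \<star> Z)" for Z :: "real^'l^'p^'p"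
    by (metis inner_tprod_left)
  then show ?thesis
    by (simp add: tbelow_def tprod.add_left inner_add_right tprod_assoc)
qed

lemma ttrans_gram: "ttrans (tid + ttrans V \<star> V) = tid + ttrans V \<star> V"
  by (simp add: ttrans_add ttrans_tprod)

text \<open>Pair the operator with \<open>D\<close> and apply Cauchy-Schwarz. The term D * T is
  treated by transposing, where symmetry of \<open>T\<close> makes it a left multiplication.\<close>

lemma lyapunov_lower:
  fixes D :: "real^'l::finite^'p^'p"
  assumes S: "tbelow m S" and T: "tbelow m' T" "ttrans T = T"
  shows "(m + m') * norm D \<le> norm (S \<star> D + D \<star> T)"
proof -
  have "D \<bullet> (D \<star> T) = ttrans D \<bullet> (T \<star> ttrans D)"
    using inner_ttrans[of D "D \<star> T"] by (simp add: ttrans_tprod T(2))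
  then have "m' * (D \<bullet> D) \<le> D \<bullet> (D \<star> T)"
    using tbelowD[OF T(1), of "ttrans D"] by (simp add: inner_ttrans)
  moreover have "m * (D \<bullet> D) \<le> D \<bullet> (S \<star> D)" by (rule tbelowD[OF S])
  ultimately have "(m + m') * (D \<bullet> D) \<le> D \<bullet> (S \<star> D + D \<star> T)"
    by (simp add: inner_add_right algebra_simps)
  also have "\<dots> \<le> norm D * norm (S \<star> D + D \<star> T)" by (rule norm_cauchy_schwarz)
  finally have "norm D * ((m + m') * norm D) \<le> norm D * norm (S \<star> D + D \<star> T)"
    by (simp add: dot_square_norm power2_eq_square mult_ac)
  then show ?thesis by (cases "D = 0") auto
qed

lemma lyapunov_inj:
  fixes D :: "real^'l::finite^'p^'p"
  assumes "tbelow m S" "0 < m" "tbelow 0 T" "ttrans T = T" "S \<star> D + D \<star> T = 0"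
  shows "D = 0"
proof -
  have "m * norm D \<le> 0" using lyapunov_lower[OF assms(1,3,4), of D] assms(5) by simp
  then show ?thesis using assms(2) by (simp add: mult_le_0_iff)
qed

text \<open>An injective linear endomorphism of a finite-dimensional space is onto.\<close>

lemma lyapunov_surj:
  fixes Y :: "real^'l::finite^'p^'p"
  assumes "tbelow m S" "0 < m" "tbelow 0 T" "ttrans T = T"
  shows "\<exists>D::real^'l^'p^'p. S \<star> D + D \<star> T = Y"
proof -
  have "linear (\<lambda>D::real^'l^'p^'p. S \<star> D + D \<star> T)"
    by (auto intro!: linearI simp: tprod.add_left tprod.add_right tprod.scaleR_left
        tprod.scaleR_right algebra_simps)
  moreover from this have "inj (\<lambda>D::real^'l^'p^'p. S \<star> D + D \<star> T)"
    by (subst linear_injective_0) (use lyapunov_inj[OF assms] in blast)+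
  ultimately have "surj (\<lambda>D::real^'l^'p^'p. S \<star> D + D \<star> T)" by (rule linear_inj_imp_surj)
  from surjD[OF this, of Y] show ?thesis by blast
qed

section \<open>Existence and uniqueness of the square root\<close>

lemma norm_tprod_right_le:
  assumes "ttrans Y = Y" "\<forall>Z::real^'l^'p^'p. norm (Y \<star> Z) \<le> r * norm Z"
  shows "norm (D \<star> Y) \<le> r * norm (D :: real^'l::finite^'p^'p)"
proof -
  have "norm (D \<star> Y) = norm (Y \<star> ttrans D)"
    using norm_ttrans[of "D \<star> Y"] by (simp add: ttrans_tprod assms(1))
  also have "\<dots> \<le> r * norm (ttrans D)" using assms(2) by blast
  finally show ?thesis by simp
qed

text \<open>If \<open>B = I - A\<close> is a strict contraction, the fixed point \<open>Y\<close> of \<open>Y \<mapsto> (B + Y\<^sup>2) / 2\<close>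
  satisfies \<open>(I - Y)\<^sup>2 = I - B\<close>.\<close>
lemma tsqrt_exists_contraction:
  fixes A :: "real^'l::finite^'p^'p"
  assumes sym: "ttrans A = A" and r: "0 \<le> r" "r < 1"
    and B: "\<And>Z::real^'l^'p^'p. norm (Z - A \<star> Z) \<le> r * norm Z"
  shows "\<exists>S. ttrans S = S \<and> tbelow (1 - r) S \<and> S \<star> S = A"
proof -
  \<comment> \<open>Besides bounding the operator norm by \<open>r\<close>, membership demands
    symmetry, so that the same bound holds for right multiplication in the contraction
    estimate.\<close>
  define M where "M = {Y. ttrans Y = Y \<and> (\<forall>Z::real^'l^'p^'p. norm (Y \<star> Z) \<le> r * norm Z)}"
  define f where "f Y = (1/2) *\<^sub>R ((tid - A) + Y \<star> Y)" for Y
  have "closed M"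
    unfolding M_def
    by (intro closed_Collect_conj closed_Collect_all closed_Collect_eq closed_Collect_le
        continuous_intros linear_continuous_on bounded_linear_ttrans tprod.continuous_on)
  then have cM: "complete M" by (simp add: complete_eq_closed)
  have "f Y \<in> M" if "Y \<in> M" for Y
  proof -
    have Y: "ttrans Y = Y" "\<And>Z::real^'l^'p^'p. norm (Y \<star> Z) \<le> r * norm Z"
      using that by (auto simp: M_def)
    have "norm (f Y \<star> Z) \<le> r * norm Z" for Z :: "real^'l^'p^'p"
    proof -
      have "norm (Y \<star> (Y \<star> Z)) \<le> r * (r * norm Z)"
        using Y(2)[of "Y \<star> Z"] mult_left_mono[OF Y(2)[of Z] r(1)] by linarith
      also have "\<dots> \<le> 1 * (r * norm Z)" by (rule mult_right_mono) (use r in auto)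
      finally have "norm (Y \<star> (Y \<star> Z)) \<le> r * norm Z" by simp
      then have "norm ((Z - A \<star> Z) + Y \<star> (Y \<star> Z)) \<le> 2 * (r * norm Z)"
        using B[of Z] norm_triangle_ineq[of "Z - A \<star> Z" "Y \<star> (Y \<star> Z)"] by linarith
      then show ?thesis
        by (simp add: f_def tprod.scaleR_left tprod.add_left tprod.diff_left tprod_assoc)
    qed
    then show ?thesis
      by (simp add: M_def f_def ttrans_add ttrans_diff ttrans_scaleR ttrans_tprod sym Y(1))
  qed
  then have fM: "f ` M \<subseteq> M" by blast
  have "dist (f X) (f Y) \<le> r * dist X Y" if "X \<in> M" "Y \<in> M" for X Y
  proof -
    have X: "\<And>Z::real^'l^'p^'p. norm (X \<star> Z) \<le> r * norm Z" and
      Y: "ttrans Y = Y" "\<forall>Z::real^'l^'p^'p. norm (Y \<star> Z) \<le> r * norm Z"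
      using that by (auto simp: M_def)
    \<comment> \<open>A difference of squares split without commuting the factors.\<close>
    have "f X - f Y = (1/2) *\<^sub>R (X \<star> (X - Y) + (X - Y) \<star> Y)"
      by (simp add: f_def tprod.diff_left tprod.diff_right algebra_simps)
    then have "norm (f X - f Y) = norm (X \<star> (X - Y) + (X - Y) \<star> Y) / 2" by simp
    also have "\<dots> \<le> (norm (X \<star> (X - Y)) + norm ((X - Y) \<star> Y)) / 2"
      by (simp add: norm_triangle_ineq)
    also have "\<dots> \<le> r * norm (X - Y)"
      using add_mono[OF X[of "X - Y"] norm_tprod_right_le[OF Y, of "X - Y"]] by simp
    finally show ?thesis by (simp add: dist_norm)
  qed
  moreover have "0 \<in> M" using r by (simp add: M_def tprod.zero_left)
  ultimately obtain Y where "Y \<in> M" "f Y = Y"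
    using Banach_fix[OF cM _ r fM] by blast
  then have Y: "ttrans Y = Y" "\<And>Z::real^'l^'p^'p. norm (Y \<star> Z) \<le> r * norm Z"
    and fix_Y: "tid - A + Y \<star> Y = 2 *\<^sub>R Y"
    by (auto simp: M_def f_def) (metis (no_types) scaleR_half_double scaleR_2 scaleR_right_distrib)
  have "(1 - r) * (Z \<bullet> Z) \<le> Z \<bullet> ((tid - Y) \<star> Z)" for Z :: "real^'l^'p^'p"
  proof -
    have "Z \<bullet> (Y \<star> Z) \<le> norm Z * norm (Y \<star> Z)" by (rule norm_cauchy_schwarz)
    also have "\<dots> \<le> norm Z * (r * norm Z)" by (rule mult_left_mono[OF Y(2)]) simp
    also have "\<dots> = r * (Z \<bullet> Z)" by (simp add: dot_square_norm power2_eq_square)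
    finally show ?thesis by (simp add: tprod.diff_left inner_diff_right algebra_simps)
  qed
  moreover have "(tid - Y) \<star> (tid - Y) = A"
    using fix_Y by (simp add: tprod.diff_left tprod.diff_right scaleR_2 algebra_simps)
  ultimately show ?thesis
    by (intro exI[of _ "tid - Y"]) (simp add: ttrans_diff Y(1) tbelow_def)
qed

text \<open>Rescaling brings \<open>A\<close> close enough to the identity for the contraction
  argument; the root is then scaled back by 1 / sqrt t.\<close>

lemma tsqrt_exists:
  fixes A :: "real^'l::finite^'p^'p"
  assumes sym: "ttrans A = A" and A: "tbelow m A" "0 < m"
  shows "\<exists>S m'. 0 < m' \<and> ttrans S = S \<and> tbelow m' S \<and> S \<star> S = A"
proof -
  obtain K where K: "0 < K" "\<And>Z::real^'l^'p^'p. norm (A \<star> Z) \<le> norm Z * K"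
    using bounded_linear.pos_bounded[OF tprod.bounded_linear_right] by blast
  \<comment> \<open>The maximum ensures m \<le> c, which keeps the radicand in \<open>r\<close>
    nonnegative.\<close>
  define c where "c = max K m"
  have c: "0 < c" "m \<le> c" using K by (auto simp: c_def)
  \<comment> \<open>This \<open>t\<close> minimises 1 - 2 t m + t^2 c^2, the factor bounding the
    squared norm of Z - t A * Z; the minimum is 1 - m^2 / c^2.\<close>
  define t where "t = m / c\<^sup>2"
  have t: "0 < t" using A c by (simp add: t_def)
  define r where "r = sqrt (1 - m\<^sup>2 / c\<^sup>2)"
  have "m\<^sup>2 / c\<^sup>2 \<le> 1" using c A by (simp add: power_mono)
  then have r: "0 \<le> r" "r < 1" "r\<^sup>2 = 1 - m\<^sup>2 / c\<^sup>2"
    using A c by (simp_all add: r_def)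
  have "norm (Z - (t *\<^sub>R A) \<star> Z) \<le> r * norm Z" for Z :: "real^'l^'p^'p"
  proof (rule power2_le_imp_le)
    have "norm (A \<star> Z) \<le> c * norm Z"
      using K(2)[of Z] mult_right_mono[of K c "norm Z"] by (simp add: c_def mult_ac)
    then have "(norm (A \<star> Z))\<^sup>2 \<le> (c * norm Z)\<^sup>2" by (rule power_mono) simp
    then have "t\<^sup>2 * (norm (A \<star> Z))\<^sup>2 \<le> t\<^sup>2 * (c * norm Z)\<^sup>2" by (rule mult_left_mono) simp
    moreover have "t * (m * (Z \<bullet> Z)) \<le> t * (Z \<bullet> (A \<star> Z))"
      using A t by (intro mult_left_mono) (auto simp: tbelow_def)
    moreover have "(norm (Z - (t *\<^sub>R A) \<star> Z))\<^sup>2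
        = (norm Z)\<^sup>2 - 2 * (t * (Z \<bullet> (A \<star> Z))) + t\<^sup>2 * (norm (A \<star> Z))\<^sup>2"
      unfolding power2_norm_eq_inner
      by (simp add: tprod.scaleR_left inner_diff_left inner_diff_right
          inner_commute power2_eq_square algebra_simps)
    ultimately have "(norm (Z - (t *\<^sub>R A) \<star> Z))\<^sup>2
        \<le> (norm Z)\<^sup>2 - 2 * (t * (m * (norm Z)\<^sup>2)) + t\<^sup>2 * (c * norm Z)\<^sup>2"
      by (simp add: power2_norm_eq_inner)
    also have "\<dots> = r\<^sup>2 * (norm Z)\<^sup>2"
      unfolding r(3) using c by (simp add: power_mult_distrib t_def field_simps power2_eq_square)
    also have "\<dots> = (r * norm Z)\<^sup>2" by (simp add: power_mult_distrib)
    finally show "(norm (Z - (t *\<^sub>R A) \<star> Z))\<^sup>2 \<le> (r * norm Z)\<^sup>2" .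
  qed (use r in simp)
  moreover have "ttrans (t *\<^sub>R A) = t *\<^sub>R A" by (simp add: ttrans_scaleR sym)
  ultimately obtain S where S: "ttrans S = S" "tbelow (1 - r) S" "S \<star> S = t *\<^sub>R A"
    using tsqrt_exists_contraction[of "t *\<^sub>R A" r] r by blast
  define S' where "S' = (1 / sqrt t) *\<^sub>R S"
  have "tbelow ((1 - r) / sqrt t) S'"
    using S(2) t by (simp add: tbelow_def S'_def tprod.scaleR_left divide_right_mono)
  moreover have "S' \<star> S' = A"
    using t by (simp add: S'_def tprod.scaleR_left tprod.scaleR_right S(3))
  moreover have "ttrans S' = S'" by (simp add: S'_def ttrans_scaleR S(1))
  moreover have "0 < (1 - r) / sqrt t" using r t by simp
  ultimately show ?thesis by blast
qed

text \<open>Equal squares make S - T a solution of a homogeneous Lyapunov equation. The competitor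
  \<open>T\<close> is merely semidefinite, as in the description defining
  \<open>tsqrt\<close>.\<close>

lemma tsqrt_unique:
  assumes "ttrans S = S" "tbelow m S" "0 < m" "t_psd T" "T \<star> T = S \<star> S"
  shows "T = S"
proof -
  have "S \<star> (S - T) + (S - T) \<star> T = 0"
    using assms(5) by (simp add: tprod.diff_left tprod.diff_right)
  then have "S - T = 0"
    using lyapunov_inj assms by (metis t_psd_iff)
  then show ?thesis by simp
qed

lemma tsqrt_spec:
  assumes "ttrans A = A" "tbelow m A" "0 < m"
  shows "ttrans (tsqrt A) = tsqrt A" "tsqrt A \<star> tsqrt A = A" "\<exists>m'>0. tbelow m' (tsqrt A)"
proof -
  obtain S m' where S: "0 < m'" "ttrans S = S" "tbelow m' S" "S \<star> S = A"
    using tsqrt_exists[OF assms] by blast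
  then have "t_psd S" by (simp add: t_psd_iff tbelow_0_if)
  have "tsqrt A = S"
    unfolding tsqrt_def
  proof (rule the_equality)
    show "T = S" if "t_psd T \<and> T \<star> T = A" for T
      using tsqrt_unique[OF S(2,3,1)] that S(4) by simp
  qed (use \<open>t_psd S\<close> S in simp)
  then show "ttrans (tsqrt A) = tsqrt A" "tsqrt A \<star> tsqrt A = A" "\<exists>m'>0. tbelow m' (tsqrt A)"
    using S by auto
qed

section \<open>Inverses for the t-product\<close>

lemma tinv_eqI:
  assumes "A \<star> B = tid" "B \<star> A = tid"
  shows "tinv A = B"
  unfolding tinv_def
  using assms by (intro the_equality) (auto, metis tprod_assoc tprod_tid_left tprod_tid_right)

text \<open>Coercivity makes left multiplication by \<open>S\<close> injective, hence onto, giving a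
  right inverse. Its transpose is a left inverse, and the two must coincide.\<close>

lemma tinv_spec:
  fixes S :: "real^'l::finite^'p^'p"
  assumes "ttrans S = S" "tbelow m S" "0 < m"
  shows "S \<star> tinv S = tid" "tinv S \<star> S = tid" "ttrans (tinv S) = tinv S"
proof -
  have "linear ((\<star>) S :: real^'l^'p^'p \<Rightarrow> real^'l^'p^'p)"
    by (intro bounded_linear.linear tprod.bounded_linear_right)
  moreover from this have "inj ((\<star>) S :: real^'l^'p^'p \<Rightarrow> real^'l^'p^'p)"
  proof (subst linear_injective_0, assumption, intro allI impI)
    fix Z :: "real^'l^'p^'p" assume "S \<star> Z = 0"
    then have "m * (Z \<bullet> Z) \<le> 0" using tbelowD[OF assms(2), of Z] by simp
    then show "Z = 0" using assms(3) by (metis inner_gt_zero_iff mult_pos_pos not_le)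
  qed
  ultimately have "surj ((\<star>) S :: real^'l^'p^'p \<Rightarrow> real^'l^'p^'p)"
    by (rule linear_inj_imp_surj)
  from surjD[OF this, of tid] obtain W where W: "S \<star> W = tid" by metis
  then have W': "ttrans W \<star> S = tid" by (metis ttrans_tprod ttrans_tid assms(1))
  then have "ttrans W = W" using W by (metis tprod_assoc tprod_tid_left tprod_tid_right)
  then show "S \<star> tinv S = tid" "tinv S \<star> S = tid" "ttrans (tinv S) = tinv S"
    using W W' tinv_eqI[of S W] by auto
qed

section \<open>Smoothness\<close>

text \<open>Induction on the list of directions keeps every iterated derivative inside
  \<open>P\<close>, so smoothness reduces to finding an invariant class of differentiable
  functions.\<close>

lemma smooth_on_open_UNIV_coinduct:
  assumes "P f"
    and step: "\<And>f. P f \<Longrightarrow> \<exists>f'. (\<forall>x. (f has_derivative f' x) (at x)) \<and> (\<forall>h. P (\<lambda>x. f' x h))"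
  shows "smooth_on_open UNIV f"
proof -
  have "P (dderiv f hs)" for hs
  proof (induction hs)
    case (Cons h hs)
    from step[OF this] obtain f' where f': "\<forall>x. (dderiv f hs has_derivative f' x) (at x)"
      "\<forall>h. P (\<lambda>x. f' x h)" by blast
    then have "frechet_derivative (dderiv f hs) (at x) = f' x" for x
      using frechet_derivative_at by metis
    then have "dderiv f (h # hs) = (\<lambda>x. f' x h)" by simp
    then show ?case using f'(2) by simp
  qed (simp add: assms(1))
  then show ?thesis
    unfolding smooth_on_open_def differentiable_on_def
    using step by (meson differentiable_def has_derivative_at_withinI open_UNIV)
qed

lemma has_derivative_local_lipschitz:
  assumes "(f has_derivative f') (at x)"
  obtains C where "\<forall>\<^sub>F y in at x. norm (f y - f x) \<le> C * norm (y - x)"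
proof -
  obtain K where K: "\<And>h. norm (f' h) \<le> norm h * K"
    using bounded_linear.bounded[OF has_derivative_bounded_linear[OF assms]] by blast
  have "((\<lambda>y. norm (f y - f x - f' (y - x)) / norm (y - x)) \<longlongrightarrow> 0) (at x)"
    using assms by (simp add: has_derivative_iff_norm)
  from order_tendstoD(2)[OF this zero_less_one]
  have "\<forall>\<^sub>F y in at x. norm (f y - f x - f' (y - x)) / norm (y - x) < 1" .
  then have "\<forall>\<^sub>F y in at x. norm (f y - f x) \<le> (K + 1) * norm (y - x)"
    using eventually_neq_at_within[of x x]
  proof eventually_elim
    case (elim y)
    then have "norm (f y - f x - f' (y - x)) \<le> norm (y - x)" by (simp add: divide_simps)
    then show ?case
      using K[of "y - x"] norm_triangle_sub[of "f y - f x" "f' (y - x)"]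
      by (simp add: algebra_simps)
  qed
  then show ?thesis by (rule that)
qed

text \<open>A factor of order |y - x| times a factor tending to 0 is o(|y - x|). This disposes of
  the second-order remainders in the two implicit differentiations below.\<close>

lemma (in bounded_bilinear) has_derivative_prod_zero:
  assumes f: "f x = 0" "\<forall>\<^sub>F y in at x. norm (f y) \<le> C * norm (y - x)" and g: "(g \<longlongrightarrow> 0) (at x)"
  shows "((\<lambda>y. prod (f y) (g y)) has_derivative (\<lambda>h. 0)) (at x)"
proof -
  obtain K where K: "0 < K" "\<And>a b. norm (prod a b) \<le> norm a * norm b * K"
    using pos_bounded by blast
  have "\<forall>\<^sub>F y in at x. norm (norm (prod (f y) (g y)) / norm (y - x)) \<le> C * K * norm (g y)"
    using f(2) eventually_neq_at_within[of x x]
  proof eventually_elim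
    case (elim y)
    have "norm (prod (f y) (g y)) \<le> norm (f y) * (norm (g y) * K)"
      using K(2)[of "f y" "g y"] by (simp add: mult_ac)
    also have "\<dots> \<le> C * norm (y - x) * (norm (g y) * K)"
      using elim K by (intro mult_right_mono) auto
    finally show ?case using elim(2) by (simp add: divide_simps mult_ac)
  qed
  then have "((\<lambda>y. norm (prod (f y) (g y)) / norm (y - x)) \<longlongrightarrow> 0) (at x)"
    by (rule Lim_null_comparison) (intro tendsto_mult_right_zero tendsto_norm_zero g)
  then show ?thesis by (simp add: has_derivative_iff_norm f(1) zero_left)
qed

section \<open>The Lyapunov solution operator and differentiation through it\<close>

definition lyap :: "real^'l::finite^'p^'p \<Rightarrow> real^'l^'p^'p \<Rightarrow> real^'l^'p^'p" where
  "lyap S Y = (SOME Q. S \<star> Q + Q \<star> S = Y)"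

definition tspd :: "real^'l::finite^'p^'p \<Rightarrow> bool" where
  "tspd S \<longleftrightarrow> ttrans S = S \<and> (\<exists>m>0. tbelow m S)"

lemma lyap_spec: "tspd S \<Longrightarrow> S \<star> lyap S Y + lyap S Y \<star> S = Y"
  unfolding lyap_def
  by (rule someI_ex) (meson lyapunov_surj tspd_def tbelow_0_if less_imp_le)

text \<open>Uniqueness pins down the choice made in \<open>lyap\<close>, so linearity and the exact
  remainder identities can be proved by exhibiting solutions.\<close>

lemma lyap_eqI:
  assumes "tspd S" "S \<star> Q + Q \<star> S = Y"
  shows "lyap S Y = Q"
proof -
  have "S \<star> (lyap S Y - Q) + (lyap S Y - Q) \<star> S = 0"
    using lyap_spec[OF assms(1), of Y] assms(2)
    by (simp add: tprod.diff_left tprod.diff_right algebra_simps)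
  then have "lyap S Y - Q = 0"
    using assms(1) lyapunov_inj tbelow_0_if unfolding tspd_def by (metis less_imp_le)
  then show ?thesis by simp
qed

lemma bounded_linear_lyap:
  assumes "tspd (S :: real^'l::finite^'p^'p)"
  shows "bounded_linear (lyap S)"
  unfolding linear_conv_bounded_linear[symmetric]
proof (rule linearI)
  fix X Y :: "real^'l^'p^'p" and c :: real
  show "lyap S (X + Y) = lyap S X + lyap S Y"
    using lyap_spec[OF assms, of X] lyap_spec[OF assms, of Y]
    by (intro lyap_eqI[OF assms]) (simp add: tprod.add_left tprod.add_right algebra_simps)
  have "S \<star> (c *\<^sub>R lyap S X) + (c *\<^sub>R lyap S X) \<star> S = c *\<^sub>R (S \<star> lyap S X + lyap S X \<star> S)"
    by (simp add: tprod.scaleR_left tprod.scaleR_right scaleR_right_distrib)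
  then show "lyap S (c *\<^sub>R X) = c *\<^sub>R lyap S X"
    by (intro lyap_eqI[OF assms]) (simp add: lyap_spec[OF assms])
qed

lemma tinv_eq_lyap: "tspd S \<Longrightarrow> tinv S = lyap S (2 *\<^sub>R tid)"
  by (metis lyap_eqI scaleR_2 tinv_spec(1,2) tspd_def)

lemma tspd_tid: "tspd tid"
  unfolding tspd_def tbelow_def by (intro conjI exI[of _ 1]) simp_all

text \<open>With \<open>D = S y - S x\<close> one has \<open>S x * D + D * S x = A y - A x - D * D\<close>, and \<open>D * D\<close> is
  negligible because \<open>D\<close> is Lipschitz in \<open>A\<close>.\<close>
lemma has_derivative_square_root:
  fixes S :: "'a::real_normed_vector \<Rightarrow> real^'l::finite^'p^'p"
  assumes S: "\<And>y. tspd (S y)" and A: "((\<lambda>y. S y \<star> S y) has_derivative A') (at x)"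
  shows "(S has_derivative (\<lambda>h. lyap (S x) (A' h))) (at x)"
proof -
  let ?A = "\<lambda>y. S y \<star> S y" and ?D = "\<lambda>y. S y - S x"
  obtain m where m: "0 < m" "tbelow m (S x)" using S[of x] by (auto simp: tspd_def)
  \<comment> \<open>The lower bound is taken from \<open>S x\<close>, while \<open>S y\<close>
    contributes 0, so the constant does not depend on y.\<close>
  have lip: "m * norm (?D y) \<le> norm (?A y - ?A x)" for y
  proof -
    have "ttrans (S y) = S y" "tbelow 0 (S y)" 
      using S[of y] tbelow_0_if less_imp_le by (auto simp: tspd_def)
    from lyapunov_lower[OF m(2) this(2,1), of "?D y"]
    show ?thesis by (simp add: tprod.diff_left tprod.diff_right)
  qed
  obtain C where "\<forall>\<^sub>F y in at x. norm (?A y - ?A x) \<le> C * norm (y - x)"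
    using has_derivative_local_lipschitz[OF A] by blast
  then have D: "\<forall>\<^sub>F y in at x. norm (?D y) \<le> C / m * norm (y - x)"
  proof eventually_elim
    case (elim y)
    then show ?case using lip[of y] m(1) by (simp add: field_simps)
  qed
  then have "(?D \<longlongrightarrow> 0) (at x)"
    by (rule Lim_null_comparison) (use m(1) in \<open>auto intro!: tendsto_eq_intros\<close>)
  from tprod.has_derivative_prod_zero[OF _ D this]
  have "((\<lambda>y. ?D y \<star> ?D y) has_derivative (\<lambda>h. 0)) (at x)" by simp
  then have "((\<lambda>y. S x + lyap (S x) (?A y - ?A x - ?D y \<star> ?D y)) has_derivative
      (\<lambda>h. 0 + lyap (S x) (A' h - 0 - 0))) (at x)"
    by (intro has_derivative_add has_derivative_const has_derivative_diff A
        bounded_linear.has_derivative[OF bounded_linear_lyap[OF S]])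
  moreover have "lyap (S x) (?A y - ?A x - ?D y \<star> ?D y) = ?D y" for y
    by (rule lyap_eqI[OF S]) (simp add: tprod.diff_left tprod.diff_right)
  ultimately show ?thesis by simp
qed

text \<open>Freeze the coefficient at x: \<open>Q y\<close> is then the fixed linear map
  \<open>lyap (S x)\<close> applied to explicit terms plus products of \<open>?D\<close> and
  \<open>?E\<close>. Continuity of \<open>Q\<close> at x comes first, since it makes those products
  negligible.\<close>

lemma has_derivative_lyap:
  fixes S :: "'a::real_normed_vector \<Rightarrow> real^'l::finite^'p^'p"
  assumes tspd: "\<And>y. tspd (S y)" and S: "(S has_derivative S') (at x)"
    and Y: "(Y has_derivative Y') (at x)"
  defines "Q \<equiv> \<lambda>y. lyap (S y) (Y y)"
  shows "(Q has_derivative (\<lambda>h. lyap (S x) (Y' h - (S' h \<star> Q x + Q x \<star> S' h)))) (at x)"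
proof -
  let ?D = "\<lambda>y. S y - S x" and ?E = "\<lambda>y. Q y - Q x"
  obtain m where m: "0 < m" "tbelow m (S x)" "ttrans (S x) = S x"
    using tspd[of x] by (auto simp: tspd_def)
  have Q: "S y \<star> Q y + Q y \<star> S y = Y y" for y
    unfolding Q_def by (rule lyap_spec[OF tspd])
  have eq: "S x \<star> Q y + Q y \<star> S x = Y y - (?D y \<star> Q y + Q y \<star> ?D y)" for y
    by (simp add: Q[of y, symmetric] tprod.diff_left tprod.diff_right)
  obtain K where K: "0 < K" "\<And>(a :: real^'l^'p^'p) (b :: real^'l^'p^'p). norm (a \<star> b) \<le> norm a * norm b * K"
    using tprod.pos_bounded by blast
  have D0: "(?D \<longlongrightarrow> 0) (at x)"
    using has_derivative_continuous[OF S] by (simp add: continuous_within LIM_zero)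
  have Y0: "((\<lambda>y. Y y - Y x) \<longlongrightarrow> 0) (at x)"
    using has_derivative_continuous[OF Y] by (simp add: continuous_within LIM_zero)
  \<comment> \<open>Below this threshold the error term containing \<open>?E\<close> is at most m
    times its norm, and is absorbed by the factor 2 m from coercivity.\<close>
  have "\<forall>\<^sub>F y in at x. norm (?D y) < m / (2 * K)"
    using tendsto_norm_zero[OF D0] m K by (intro order_tendstoD(2)) auto
  then have "\<forall>\<^sub>F y in at x. norm (?E y) \<le> (norm (Y y - Y x) + 2 * K * norm (Q x) * norm (?D y)) / m"
  proof eventually_elim
    case (elim y)
    have sylv: "S x \<star> ?E y + ?E y \<star> S x = (Y y - Y x) - (?D y \<star> Q x + Q x \<star> ?D y)
        - (?D y \<star> ?E y + ?E y \<star> ?D y)"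
      using eq[of y] Q[of x] by (simp add: tprod.diff_left tprod.diff_right algebra_simps)
    have DE: "norm (?D y \<star> Z + Z \<star> ?D y) \<le> 2 * K * norm Z * norm (?D y)"
      for Z :: "real^'l^'p^'p"
      using K(2)[of "?D y" Z] K(2)[of Z "?D y"] norm_triangle_ineq[of "?D y \<star> Z" "Z \<star> ?D y"]
      by (simp add: mult_ac)
    have "2 * m * norm (?E y) \<le> norm (S x \<star> ?E y + ?E y \<star> S x)"
      using lyapunov_lower[OF m(2,2,3), of "?E y"] by simp
    also have "\<dots> \<le> norm (Y y - Y x) + 2 * K * norm (Q x) * norm (?D y)
        + 2 * K * norm (?E y) * norm (?D y)"
      unfolding sylv using DE[of "Q x"] DE[of "?E y"]
        norm_triangle_ineq4[of "Y y - Y x" "?D y \<star> Q x + Q x \<star> ?D y"]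
        norm_triangle_ineq4[of "(Y y - Y x) - (?D y \<star> Q x + Q x \<star> ?D y)"
          "?D y \<star> ?E y + ?E y \<star> ?D y"] by linarith
    finally have "2 * m * norm (?E y) \<le> norm (Y y - Y x) + 2 * K * norm (Q x) * norm (?D y)
        + 2 * K * norm (?E y) * norm (?D y)" .
    moreover have "2 * K * norm (?E y) * norm (?D y) \<le> m * norm (?E y)"
    proof -
      have "2 * K * norm (?D y) \<le> m" using elim K by (simp add: field_simps)
      from mult_right_mono[OF this norm_ge_zero[of "?E y"]] show ?thesis by (simp add: mult_ac)
    qed
    ultimately have "m * norm (?E y) \<le> norm (Y y - Y x) + 2 * K * norm (Q x) * norm (?D y)"
      by linarith
    then show ?case using m(1) by (simp add: field_simps)
  qed
  moreover have "((\<lambda>y. (norm (Y y - Y x) + 2 * K * norm (Q x) * norm (?D y)) / m) \<longlongrightarrow> 0) (at x)"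
    by (intro tendsto_divide_zero tendsto_add_zero tendsto_mult_right_zero tendsto_norm_zero D0 Y0)
  ultimately have E0: "(?E \<longlongrightarrow> 0) (at x)" by (rule Lim_null_comparison)
  obtain C where D: "\<forall>\<^sub>F y in at x. norm (?D y) \<le> C * norm (y - x)"
    using has_derivative_local_lipschitz[OF S] by blast
  have small: "((\<lambda>y. ?D y \<star> ?E y) has_derivative (\<lambda>h. 0)) (at x)"
    "((\<lambda>y. ?E y \<star> ?D y) has_derivative (\<lambda>h. 0)) (at x)"
    using tprod.has_derivative_prod_zero[OF _ D E0]
      bounded_bilinear.has_derivative_prod_zero[OF bounded_bilinear.flip[OF bounded_bilinear_tprod] _ D E0]
    by simp_all
  have D': "(?D has_derivative S') (at x)"
    using has_derivative_diff[OF S has_derivative_const[of "S x"]] by simp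
  have "((\<lambda>y. lyap (S x) (Y y - ((?D y \<star> Q x + Q x \<star> ?D y) + (?D y \<star> ?E y + ?E y \<star> ?D y))))
      has_derivative (\<lambda>h. lyap (S x) (Y' h - ((S' h \<star> Q x + Q x \<star> S' h) + (0 + 0))))) (at x)"
    by (intro bounded_linear.has_derivative[OF bounded_linear_lyap[OF tspd]]
        has_derivative_diff has_derivative_add Y small D'
        bounded_linear.has_derivative[OF tprod.bounded_linear_left]
        bounded_linear.has_derivative[OF tprod.bounded_linear_right])
  moreover have "lyap (S x) (Y y - ((?D y \<star> Q x + Q x \<star> ?D y) + (?D y \<star> ?E y + ?E y \<star> ?D y))) = Q y" for y
    by (rule lyap_eqI[OF tspd])
      (use eq[of y] in \<open>simp add: tprod.diff_left tprod.diff_right algebra_simps\<close>)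
  ultimately show ?thesis by simp
qed

section \<open>The retraction\<close>

definition gsqrt :: "real^'l^'p^'n \<Rightarrow> real^'l::finite^'p^'p" where
  "gsqrt V = tsqrt (tid + ttrans V \<star> V)"

lemma tspd_gsqrt: "tspd (gsqrt V)"
  and gsqrt_sq: "gsqrt V \<star> gsqrt V = tid + ttrans V \<star> V"
  unfolding tspd_def gsqrt_def
  using tsqrt_spec[OF ttrans_gram tbelow_gram zero_less_one] by auto

lemma gsqrt_zero: "gsqrt (0 :: real^'l^'p^'n) = (tid :: real^'l::finite^'p^'p)"
proof -
  obtain m where "0 < m" "tbelow m (tid :: real^'l^'p^'p)" using tspd_tid by (auto simp: tspd_def)
  moreover have "t_psd (gsqrt (0 :: real^'l^'p^'n) :: real^'l^'p^'p)"
    using tspd_gsqrt[of "0 :: real^'l^'p^'n"] tbelow_0_if less_imp_le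
    by (auto simp: tspd_def t_psd_iff)
  ultimately show ?thesis
    using tsqrt_unique[OF ttrans_tid] gsqrt_sq[of "0 :: real^'l^'p^'n"]
    by (simp add: tprod.zero_right)
qed

lemma lyap_tid: "lyap tid (2 *\<^sub>R tid) = tid"
  by (rule lyap_eqI[OF tspd_tid]) (simp add: scaleR_2)

text \<open>Writing the inverse root as a Lyapunov solution lets one differentiation rule cover both
  inversion and the derivatives of the root.\<close>

lemma stiefel_retr_eq: "stiefel_retr X V = (X + V) \<star> lyap (gsqrt V) (2 *\<^sub>R tid)"
  by (simp add: stiefel_retr_def tinvsqrt_def gsqrt_def[symmetric] tinv_eq_lyap tspd_gsqrt)

lemma has_derivative_gram:
  "((\<lambda>z. tid + ttrans (snd z) \<star> snd z) has_derivative
    (\<lambda>h. ttrans (snd z) \<star> snd h + ttrans (snd h) \<star> (snd z :: real^'l::finite^'p^'n))) (at z)"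
  for z :: "'a::real_normed_vector \<times> (real^'l::finite^'p^'n)"
proof -
  have snd': "(snd has_derivative snd) (at z)"
    by (rule bounded_linear_imp_has_derivative[OF bounded_linear_snd])
  show ?thesis
    using has_derivative_add[OF has_derivative_const[of tid]
        tprod.FDERIV[OF bounded_linear.has_derivative[OF bounded_linear_ttrans snd'] snd']]
    by simp
qed

lemma has_derivative_gsqrt:
  "((\<lambda>z. gsqrt (snd z)) has_derivative (\<lambda>h. lyap (gsqrt (snd z))
    (ttrans (snd z) \<star> snd h + ttrans (snd h) \<star> (snd z :: real^'l::finite^'p^'n)))) (at z)"
  for z :: "'a::real_normed_vector \<times> (real^'l::finite^'p^'n)"
  using has_derivative_square_root[of "\<lambda>z. gsqrt (snd z)" _ z] has_derivative_gram[of z]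
  by (simp add: tspd_gsqrt gsqrt_sq)

section \<open>Function classes closed under directional derivatives\<close>

text \<open>Closed under directional derivatives, because the derivatives of \<open>gsqrt\<close> and of \<open>lyap\<close> are
  expressed through \<open>gsqrt\<close>, \<open>lyap\<close> and products again.\<close>
inductive lyap_class ::
  "((real^'l::finite^'p^'n) \<times> (real^'l^'p^'n) \<Rightarrow> real^'l^'p^'p) \<Rightarrow> bool" where
  linear: "bounded_linear f \<Longrightarrow> lyap_class f"
| const: "lyap_class (\<lambda>z. c)"
| gsqrt: "lyap_class (\<lambda>z. gsqrt (snd z))"
| add: "lyap_class f \<Longrightarrow> lyap_class g \<Longrightarrow> lyap_class (\<lambda>z. f z + g z)"
| diff: "lyap_class f \<Longrightarrow> lyap_class g \<Longrightarrow> lyap_class (\<lambda>z. f z - g z)"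
| prod: "lyap_class f \<Longrightarrow> lyap_class g \<Longrightarrow> lyap_class (\<lambda>z. f z \<star> g z)"
| lyap: "lyap_class f \<Longrightarrow> lyap_class (\<lambda>z. lyap (gsqrt (snd z)) (f z))"

lemma lyap_class_gsqrt_derivative:
  "\<exists>S'. (\<forall>z. ((\<lambda>z. gsqrt (snd z)) has_derivative S' z) (at z)) \<and>
    (\<forall>h :: (real^'l::finite^'p^'n) \<times> (real^'l^'p^'n). lyap_class (\<lambda>z. S' z h))"
proof -
  have "lyap_class (\<lambda>z. lyap (gsqrt (snd z)) (ttrans (snd z) \<star> snd h + ttrans (snd h) \<star> snd z))"
    for h :: "(real^'l^'p^'n) \<times> (real^'l^'p^'n)"
    by (intro lyap_class.lyap lyap_class.linear bounded_linear_add
        bounded_linear_compose[OF tprod.bounded_linear_left]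
        bounded_linear_compose[OF tprod.bounded_linear_right]
        bounded_linear_compose[OF bounded_linear_ttrans] bounded_linear_snd)
  then show ?thesis
    by (intro exI[of _ "\<lambda>z h. lyap (gsqrt (snd z)) (ttrans (snd z) \<star> snd h + ttrans (snd h) \<star> snd z)"]
        conjI allI has_derivative_gsqrt)
qed

lemma lyap_class_derivative:
  fixes f :: "(real^'l::finite^'p^'n) \<times> (real^'l^'p^'n) \<Rightarrow> real^'l^'p^'p"
  assumes "lyap_class f"
  shows "\<exists>f'. (\<forall>x. (f has_derivative f' x) (at x)) \<and> (\<forall>h. lyap_class (\<lambda>x. f' x h))"
  using assms
proof induction
  case (linear f)
  then show ?case
    by (intro exI[of _ "\<lambda>_. f"])
      (auto intro: bounded_linear_imp_has_derivative lyap_class.const)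
next
  case (const c)
  then show ?case
    by (intro exI[of _ "\<lambda>_ _. 0"]) (auto intro: lyap_class.const)
next
  case gsqrt
  show ?case by (rule lyap_class_gsqrt_derivative)
next
  case (add f g)
  then obtain f' g' where
    "\<forall>x. (f has_derivative f' x) (at x)" "\<forall>h. lyap_class (\<lambda>x. f' x h)"
    "\<forall>x. (g has_derivative g' x) (at x)" "\<forall>h. lyap_class (\<lambda>x. g' x h)" by blast
  then show ?case
    by (intro exI[of _ "\<lambda>x h. f' x h + g' x h"])
      (auto intro: has_derivative_add lyap_class.add)
next
  case (diff f g)
  then obtain f' g' where
    "\<forall>x. (f has_derivative f' x) (at x)" "\<forall>h. lyap_class (\<lambda>x. f' x h)"
    "\<forall>x. (g has_derivative g' x) (at x)" "\<forall>h. lyap_class (\<lambda>x. g' x h)" by blast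
  then show ?case
    by (intro exI[of _ "\<lambda>x h. f' x h - g' x h"])
      (auto intro: has_derivative_diff lyap_class.diff)
next
  case (prod f g)
  then obtain f' g' where
    "\<forall>x. (f has_derivative f' x) (at x)" "\<forall>h. lyap_class (\<lambda>x. f' x h)"
    "\<forall>x. (g has_derivative g' x) (at x)" "\<forall>h. lyap_class (\<lambda>x. g' x h)" by blast
  with prod(1,2) show ?case
    by (intro exI[of _ "\<lambda>x h. f x \<star> g' x h + f' x h \<star> g x"] conjI allI tprod.FDERIV
        lyap_class.add lyap_class.prod) blast+
next
  case (lyap f)
  then obtain f' where
    "\<forall>x. (f has_derivative f' x) (at x)" "\<forall>h. lyap_class (\<lambda>x. f' x h)" by blast
  moreover obtain S' :: "(real^'l^'p^'n) \<times> (real^'l^'p^'n) \<Rightarrow> _ \<Rightarrow> _" where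
    "\<forall>x. ((\<lambda>z. gsqrt (snd z)) has_derivative S' x) (at x)" "\<forall>h. lyap_class (\<lambda>x. S' x h)"
    using lyap_class_gsqrt_derivative by blast
  ultimately have f': "(f has_derivative f' x) (at x)" "lyap_class (\<lambda>x. f' x h)"
    and S': "((\<lambda>z. gsqrt (snd z)) has_derivative S' x) (at x)" "lyap_class (\<lambda>x. S' x h)" for x h
    by blast+
  show ?case
    by (intro exI[of _ "\<lambda>x h. lyap (gsqrt (snd x)) (f' x h -
          (S' x h \<star> lyap (gsqrt (snd x)) (f x) + lyap (gsqrt (snd x)) (f x) \<star> S' x h))"]
        conjI allI has_derivative_lyap tspd_gsqrt f' S' lyap.hyps
        lyap_class.lyap lyap_class.add lyap_class.diff lyap_class.prod)
qed

text \<open>A second class is needed because the values are now n x p. The constant \<open>c\<close>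
  makes room for derivatives: differentiating the affine factor leaves the constant
  \<open>f h\<close>, paired with the zero linear map.\<close>

inductive retr_class ::
  "((real^'l::finite^'p^'n) \<times> (real^'l^'p^'n) \<Rightarrow> real^'l^'p^'n) \<Rightarrow> bool" where
  prod: "bounded_linear f \<Longrightarrow> lyap_class w \<Longrightarrow> retr_class (\<lambda>z. (c + f z) \<star> w z)"
| add: "retr_class f \<Longrightarrow> retr_class g \<Longrightarrow> retr_class (\<lambda>z. f z + g z)"

lemma retr_class_derivative:
  assumes "retr_class f"
  shows "\<exists>f'. (\<forall>x. (f has_derivative f' x) (at x)) \<and> (\<forall>h. retr_class (\<lambda>x. f' x h))"
  using assms
proof induction
  case (prod f w c)
  then obtain w' where w: "\<forall>x. (w has_derivative w' x) (at x)" "\<forall>h. lyap_class (\<lambda>x. w' x h)"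
    using lyap_class_derivative by blast
  have f: "((\<lambda>z. c + f z) has_derivative f) (at x)" for x
    using has_derivative_add[OF has_derivative_const[of c]
        bounded_linear_imp_has_derivative[OF prod(1)]] by simp
  have "((\<lambda>z. (c + f z) \<star> w z) has_derivative (\<lambda>h. (c + f x) \<star> w' x h + f h \<star> w x)) (at x)" for x
    using tprod.FDERIV[OF f w(1)[rule_format]] .
  moreover have "retr_class (\<lambda>x. (c + f x) \<star> w' x h + (f h + 0) \<star> w x)" for h
    using prod w(2) by (intro retr_class.add retr_class.prod bounded_linear_zero) blast+
  ultimately show ?case
    by (intro exI[of _ "\<lambda>x h. (c + f x) \<star> w' x h + f h \<star> w x"]) simp
next
  case (add f g)
  then obtain f' g' where
    "\<forall>x. (f has_derivative f' x) (at x)" "\<forall>h. retr_class (\<lambda>x. f' x h)"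
    "\<forall>x. (g has_derivative g' x) (at x)" "\<forall>h. retr_class (\<lambda>x. g' x h)" by blast
  then show ?case
    by (intro exI[of _ "\<lambda>x h. f' x h + g' x h"])
      (auto intro: has_derivative_add retr_class.add)
qed

text \<open>Smoothness is obtained on the whole ambient product, so no charts of the tangent bundle
  are required.\<close>

lemma smooth_stiefel_retr:
  "smooth_on_open UNIV (\<lambda>(X, V). stiefel_retr X (V :: real^'l::finite^'p^'n))"
proof (rule smooth_on_open_UNIV_coinduct[of retr_class])
  have "retr_class (\<lambda>z. (0 + (fst z + snd z)) \<star> lyap (gsqrt (snd z)) (2 *\<^sub>R tid)
      :: real^'l::finite^'p^'n)"
    by (intro retr_class.prod bounded_linear_add bounded_linear_fst bounded_linear_snd
        lyap_class.lyap lyap_class.const)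
  then show "retr_class (\<lambda>(X, V). stiefel_retr X (V :: real^'l::finite^'p^'n))"
    by (simp add: case_prod_unfold stiefel_retr_eq)
qed (rule retr_class_derivative)

section \<open>First-order behaviour at zero and invariance of the Stiefel manifold\<close>

lemma stiefel_retr_zero: "stiefel_retr X 0 = X"
  by (simp add: stiefel_retr_eq gsqrt_zero lyap_tid)

text \<open>The Gram term is quadratic in V, so the normalising factor \<open>w\<close> equals the
  identity at V = 0 with vanishing derivative; only the derivative of X + V survives.\<close>

lemma stiefel_retr_vector_derivative:
  "((\<lambda>t. stiefel_retr X (t *\<^sub>R V)) has_vector_derivative (V :: real^'l::finite^'p^'n)) (at 0)"
proof -
  let ?z = "(X, 0 :: real^'l^'p^'n)"
  define w where "w = (\<lambda>z :: (real^'l^'p^'n) \<times> (real^'l^'p^'n). lyap (gsqrt (snd z)) (2 *\<^sub>R tid))"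
  have lyap_0: "lyap tid (0 :: real^'l^'p^'p) = 0"
    by (rule lyap_eqI[OF tspd_tid]) simp
  have "((\<lambda>z :: (real^'l^'p^'n) \<times> (real^'l^'p^'n). gsqrt (snd z)) has_derivative (\<lambda>h. 0)) (at ?z)"
    using has_derivative_gsqrt[of ?z] by (simp add: gsqrt_zero lyap_0 tprod.zero_left tprod.zero_right)
  from has_derivative_lyap[OF tspd_gsqrt this has_derivative_const[of "2 *\<^sub>R tid"]]
  have w: "(w has_derivative (\<lambda>h. 0)) (at ?z)"
    by (simp add: w_def gsqrt_zero lyap_0 tprod.zero_left tprod.zero_right)
  have w0: "w ?z = tid"
    by (simp add: w_def gsqrt_zero lyap_tid)
  have "((\<lambda>z. fst z + snd z) has_derivative (\<lambda>h. fst h + snd h)) (at ?z)"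
    by (intro bounded_linear_imp_has_derivative bounded_linear_add bounded_linear_fst bounded_linear_snd)
  from tprod.FDERIV[OF this w]
  have F: "((\<lambda>z. (fst z + snd z) \<star> w z) has_derivative (\<lambda>h. fst h + snd h)) (at ?z)"
    by (simp add: w0 tprod.zero_right)
  have "((\<lambda>t. (X, t *\<^sub>R V)) has_derivative (\<lambda>t. (0, t *\<^sub>R V))) (at 0)"
    by (auto intro!: derivative_eq_intros)
  from diff_chain_at[OF this, of "\<lambda>z. (fst z + snd z) \<star> w z" "\<lambda>h. fst h + snd h"] F
  show ?thesis
    by (simp add: has_vector_derivative_def o_def w_def stiefel_retr_eq)
qed

text \<open>Along a curve in the manifold the Gram tensor is constant near 0, so the product-rule
  derivative must vanish.\<close>

lemma tangent_stiefel:
  assumes "V \<in> tangent_space stiefel (X :: real^'l::finite^'p^'n)"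
  shows "ttrans X \<star> V + ttrans V \<star> X = 0"
proof -
  from assms obtain e \<gamma> where e: "0 < e" "\<forall>t\<in>{-e<..<e}. \<gamma> t \<in> stiefel" "\<gamma> 0 = X"
    and \<gamma>: "(\<gamma> has_vector_derivative V) (at 0)"
    unfolding tangent_space_def by blast
  have "((\<lambda>t. ttrans (\<gamma> t) \<star> \<gamma> t) has_vector_derivative (ttrans (\<gamma> 0) \<star> V + ttrans V \<star> \<gamma> 0)) (at 0)"
    by (intro bounded_bilinear.has_vector_derivative[OF bounded_bilinear_tprod] \<gamma>
        bounded_linear.has_vector_derivative[OF bounded_linear_ttrans])
  then have "((\<lambda>t. tid) has_vector_derivative (ttrans X \<star> V + ttrans V \<star> X)) (at 0)"
    unfolding e(3)
    by (rule has_vector_derivative_transform_within_open[where S = "{-e<..<e}"])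
      (use e in \<open>auto simp: stiefel_def\<close>)
  then show ?thesis
    by (rule vector_derivative_unique_at[OF _ has_vector_derivative_const])
qed

lemma stiefel_retr_in_stiefel:
  assumes X: "X \<in> stiefel" and V: "V \<in> tangent_space stiefel (X :: real^'l::finite^'p^'n)"
  shows "stiefel_retr X V \<in> stiefel"
proof -
  let ?S = "gsqrt V" and ?W = "tinv (gsqrt V)"
  have W: "?S \<star> ?W = tid" "?W \<star> ?S = tid" "ttrans ?W = ?W"
    using tinv_spec[of "gsqrt V"] tspd_gsqrt[of V] by (auto simp: tspd_def)
  have "ttrans (X + V) \<star> (X + V) = tid + (ttrans X \<star> V + ttrans V \<star> X) + ttrans V \<star> V"
    using X by (simp add: stiefel_def ttrans_add tprod.add_left tprod.add_right)
  also have "\<dots> = ?S \<star> ?S" by (simp add: tangent_stiefel[OF V] gsqrt_sq)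
  finally have "ttrans (X + V) \<star> (X + V) = ?S \<star> ?S" .
  \<comment> \<open>Since \<open>?W\<close> is symmetric, the Gram tensor of the retraction is S * S
    sandwiched between two copies of the inverse of S.\<close>
  moreover have "ttrans (stiefel_retr X V) \<star> stiefel_retr X V
      = ?W \<star> ((ttrans (X + V) \<star> (X + V)) \<star> ?W)"
    by (simp add: stiefel_retr_def tinvsqrt_def gsqrt_def[symmetric] ttrans_tprod W(3) tprod_assoc)
  ultimately have "ttrans (stiefel_retr X V) \<star> stiefel_retr X V = ?W \<star> (?S \<star> (?S \<star> ?W))"
    by (simp only: tprod_assoc)
  then show ?thesis by (simp add: stiefel_def W)
qed

theorem mainTheorem6:
  assumes "CARD('p::finite) \<le> CARD('n::finite)"
  shows "(\<forall>(X, V)\<in>tangent_bundle (stiefel :: (real^'l::finite^'p^'n) set).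
            t_pd (tid + ttrans V \<star> V))
       \<and> is_retraction (stiefel :: (real^'l::finite^'p^'n) set) stiefel_retr"
proof
  \<comment> \<open>This is the well-definedness: the tensor passed to \<open>tinvsqrt\<close> is
    t-positive definite.\<close>
  show "\<forall>(X, V)\<in>tangent_bundle (stiefel :: (real^'l^'p^'n) set). t_pd (tid + ttrans V \<star> V)"
    using t_pd_if_tbelow[OF ttrans_gram tbelow_gram zero_less_one] by blast
  \<comment> \<open>The ambient map itself serves as the local smooth extension at every point, with
    U the whole space.\<close>
  have "smooth_map_on (tangent_bundle (stiefel :: (real^'l^'p^'n) set)) (\<lambda>(X, V). stiefel_retr X V)"
    unfolding smooth_map_on_def using smooth_stiefel_retr by blast
  then show "is_retraction (stiefel :: (real^'l^'p^'n) set) stiefel_retr"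
    unfolding is_retraction_def
    by (auto simp: tangent_bundle_def stiefel_retr_in_stiefel stiefel_retr_zero
        stiefel_retr_vector_derivative)
qed

end
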